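(* Let $t\ge s\ge 2$ be integers. For all sufficiently large $n$: (i) $r\!\left(K_{n,n},K_{s,t},st-\lfloor (2s-1)/3\rfloor+1\right)>n^2-2\lfloor (s-2)/3\rfloor (n-1)$; (ii) if $s\ge 3$ and $t\ge 2(s-1)$, then $r\!\left(K_{n,n},K_{s,t},st-s+2\right)\ge n^2-(s-2)n+1$; (iii) if $s+t\ge 8$, then there is a constant $c>0$ (independent of $n$) such that $r\!\left(K_{n,n},K_{s,t},st-\lfloor (s+t-1)/3\rfloor\right)<n^2-c\,n^{1+3/(s+t-3)}$.
   Context: For graphs $G,H$ and an integer $q$ with $2\le q\le |E(H)|$, an $(H,q)$-coloring of $G$ is an edge-coloring of $G$ in which every subgraph of $G$ isomorphic to $H$ receives at least $q$ distinct colors; $r(G,H,q)$ is the minimum number of colors needed for $G$ to have an $(H,q)$-coloring. $K_{n,n}$, $K_{s,t}$ denote complete bipartite graphs.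
   Formalization: Part (i) is stated for s ≥ 5 only: for s = 2, 3, 4 the term ⌊(s-2)/3⌋ is 0, so (i) would claim r > n², which is false because coloring all n² edges differently gives r ≤ n². *)

theory Defs
  imports Complex_Main
begin

record 'a sgraph =
  verts :: "'a set"
  edges :: "'a set set"

definition simple_graph :: "'a sgraph \<Rightarrow> bool" where
  "simple_graph G \<longleftrightarrow> finite (verts G) \<and> (\<forall>e\<in>edges G. e \<subseteq> verts G \<and> card e = 2)"

definition subgraph :: "'a sgraph \<Rightarrow> 'a sgraph \<Rightarrow> bool" where
  "subgraph S G \<longleftrightarrow> simple_graph S \<and> verts S \<subseteq> verts G \<and> edges S \<subseteq> edges G"

definition isomorphic :: "'a sgraph \<Rightarrow> 'b sgraph \<Rightarrow> bool" where
  "isomorphic G H \<longleftrightarrow>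
     (\<exists>\<phi>. bij_betw \<phi> (verts G) (verts H) \<and> edges H = (\<lambda>e. \<phi> ` e) ` edges G)"

definition complete_bipartite :: "nat \<Rightarrow> nat \<Rightarrow> (nat + nat) sgraph" where
  "complete_bipartite m n =
     \<lparr> verts = {..<m} <+> {..<n}, edges = {{Inl i, Inr j} | i j. i < m \<and> j < n} \<rparr>"

definition HQ_coloring :: "'a sgraph \<Rightarrow> 'b sgraph \<Rightarrow> nat \<Rightarrow> ('a set \<Rightarrow> nat) \<Rightarrow> bool" where
  "HQ_coloring G H q f \<longleftrightarrow>
     (\<forall>S. subgraph S G \<and> isomorphic S H \<longrightarrow> q \<le> card (f ` edges S))"

(* Meaningful for 2 \<le> q \<le> card (edges H): then coloring the edges of the finite graph G with
   pairwise distinct colors is an (H,q)-coloring, so the minimum is attained. For larger q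
   there may be no (H,q)-coloring, and then LEAST is unspecified. *)
definition gen_ramsey :: "'a sgraph \<Rightarrow> 'b sgraph \<Rightarrow> nat \<Rightarrow> nat" where
  "gen_ramsey G H q = (LEAST k. \<exists>f. HQ_coloring G H q f \<and> card (f ` edges G) = k)"

end

theory Submission
  imports Defs "HOL-Library.Nat_Bijection"
begin

text \<open>In a coloring of \<open>K\<^bsub>n,n\<^esub>\<close> with \<open>n\<^sup>2 - R\<close> colors, keep one edge of each color as its root.
  The \<open>R\<close> other edges, each joined to the root of its color, form a hypergraph whose members meet
  each side in one or two vertices, and every member inside a copy of \<open>K\<^bsub>s,t\<^esub>\<close> costs that
  copy one color. For (ii) a vertex lies in at least the average number of members, and its star is
  small on its own side. For (i), put \<open>k = \<lfloor>(s - 2) / 3\<rfloor>\<close>; deleting vertices contained in at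
  most \<open>k\<close> members must stop, and then a star at a row and a star at a column of the first star
  together give \<open>2k + 1\<close> members on \<open>3k + 2\<close> rows and \<open>3k + 2\<close> columns. For (iii) the deletion
  method yields a large partial matching between the edges of the upper and of the lower rows with
  at most \<open>\<lfloor>(s + t - 1) / 3\<rfloor>\<close> matched pairs inside any \<open>s + t\<close> vertices; giving matched edges
  the same color, and all others their own, is the required coloring.\<close>

section \<open>Members with small traces on both sides\<close>

lemma card_UN_le_2:
  fixes \<gamma> :: "'e \<Rightarrow> 'v set"
  assumes "finite F" and "\<And>e. e \<in> F \<Longrightarrow> card (\<gamma> e) \<le> 2"
  shows "card (\<Union> (\<gamma> ` F)) \<le> 2 * card F"
proof -
  have "card (\<Union> (\<gamma> ` F)) \<le> (\<Sum>e\<in>F. card (\<gamma> e))"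
    using assms(1) by (rule card_UN_le)
  also have "\<dots> \<le> 2 * card F"
    using sum_bounded_above[of F "\<lambda>e. card (\<gamma> e)" 2] assms(2) by (simp add: mult.commute)
  finally show ?thesis .
qed

lemma card_UN_star_le:
  fixes \<gamma> :: "'e \<Rightarrow> 'v set"
  assumes "finite F" and "\<And>e. e \<in> F \<Longrightarrow> finite (\<gamma> e) \<and> card (\<gamma> e) \<le> 2 \<and> v \<in> \<gamma> e"
  shows "card (insert v (\<Union> (\<gamma> ` F))) \<le> Suc (card F)"
proof -
  have "insert v (\<Union> (\<gamma> ` F)) = insert v (\<Union>e\<in>F. \<gamma> e - {v})" by auto
  moreover have "card (\<Union>e\<in>F. \<gamma> e - {v}) \<le> (\<Sum>e\<in>F. card (\<gamma> e - {v}))"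
    using assms(1) by (rule card_UN_le)
  moreover have "(\<Sum>e\<in>F. card (\<gamma> e - {v})) \<le> card F"
    using sum_bounded_above[of F "\<lambda>e. card (\<gamma> e - {v})" 1] assms(2) by force
  ultimately show ?thesis
    using card_insert_le_m1[of "Suc (card F)" "\<Union>e\<in>F. \<gamma> e - {v}" v] by simp
qed

text \<open>Members are indices \<open>e\<close> with traces on rows and columns rather than sets,
  since different \<open>e\<close> with equal traces must count separately. A trace is a singleton
  when an edge and its root share that vertex.\<close>

locale small_hypergraph =
  fixes D :: "'e set" and \<alpha> :: "'e \<Rightarrow> 'a set" and \<beta> :: "'e \<Rightarrow> 'b set"
  assumes fin_D: "finite D"
    and \<alpha>: "e \<in> D \<Longrightarrow> finite (\<alpha> e) \<and> \<alpha> e \<noteq> {} \<and> card (\<alpha> e) \<le> 2"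
    and \<beta>: "e \<in> D \<Longrightarrow> finite (\<beta> e) \<and> \<beta> e \<noteq> {} \<and> card (\<beta> e) \<le> 2"
begin

lemma card_UN_le_double:
  assumes "F \<subseteq> D"
  shows "card (\<Union> (\<alpha> ` F)) \<le> 2 * card F" "card (\<Union> (\<beta> ` F)) \<le> 2 * card F"
proof -
  have "finite F" using assms fin_D by (rule finite_subset)
  then show "card (\<Union> (\<alpha> ` F)) \<le> 2 * card F" "card (\<Union> (\<beta> ` F)) \<le> 2 * card F"
    using assms \<alpha> \<beta> by (auto intro!: card_UN_le_2)
qed

text \<open>Pads a family to a prescribed size: each further member, however chosen, costs at most
  two vertices per side.\<close>

lemma extend_family:
  assumes "F \<subseteq> D" "card F + i \<le> card D"
    and "card (\<Union> (\<alpha> ` F)) \<le> a" "card (\<Union> (\<beta> ` F)) \<le> b"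
  obtains F' where "F \<subseteq> F'" "F' \<subseteq> D" "card F' = card F + i"
    "card (\<Union> (\<alpha> ` F')) \<le> a + 2 * i" "card (\<Union> (\<beta> ` F')) \<le> b + 2 * i"
proof -
  have finF: "finite F" using assms(1) fin_D finite_subset by blast
  have "i \<le> card (D - F)" using assms finF by (simp add: card_Diff_subset)
  then obtain G where G: "G \<subseteq> D - F" "card G = i" "finite G"
    by (rule obtain_subset_with_card_n)
  have "card (\<Union> (\<alpha> ` G)) \<le> 2 * i" "card (\<Union> (\<beta> ` G)) \<le> 2 * i"
    using card_UN_le_double[of G] G by auto
  moreover have "card (F \<union> G) = card F + i"
    using G finF by (subst card_Un_disjoint) auto
  moreover have "card (\<Union> (\<alpha> ` (F \<union> G))) \<le> card (\<Union> (\<alpha> ` F)) + card (\<Union> (\<alpha> ` G))"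
    "card (\<Union> (\<beta> ` (F \<union> G))) \<le> card (\<Union> (\<beta> ` F)) + card (\<Union> (\<beta> ` G))"
    by (simp_all add: image_Un card_Un_le)
  moreover have "F \<union> G \<subseteq> D" using G assms(1) by blast
  ultimately show ?thesis
    using assms(3,4) by (intro that[of "F \<union> G"]) auto
qed

text \<open>A row in \<open>d + 1\<close> members gives a star on \<open>d + 2\<close> rows. If all
  degrees are at most \<open>d\<close>, the incidences number at most \<open>d * card X\<close> and
  at least \<open>card D\<close>, so equality holds and all row traces are singletons. Then
  \<open>d\<close> members at one row cover only that row, and any further member fits as
  \<open>1 + 2 \<le> d + 2\<close>.\<close>

lemma dense_rows:
  assumes "finite X" "X \<noteq> {}" and sub: "\<And>e. e \<in> D \<Longrightarrow> \<alpha> e \<subseteq> X"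
    and big: "d * card X \<le> card D" and "Suc d \<le> card D" "1 \<le> d"
  obtains F where "F \<subseteq> D" "card F = Suc d"
    "card (\<Union> (\<alpha> ` F)) \<le> d + 2" "card (\<Union> (\<beta> ` F)) \<le> 2 * Suc d"
proof (cases "\<exists>v\<in>X. Suc d \<le> card {e \<in> D. v \<in> \<alpha> e}")
  case True
  then obtain v where "Suc d \<le> card {e \<in> D. v \<in> \<alpha> e}" by blast
  then obtain F where F: "F \<subseteq> {e \<in> D. v \<in> \<alpha> e}" "card F = Suc d" "finite F"
    by (rule obtain_subset_with_card_n)
  have "card (insert v (\<Union> (\<alpha> ` F))) \<le> Suc (card F)"
    using F \<alpha> by (intro card_UN_star_le) auto
  then have "card (\<Union> (\<alpha> ` F)) \<le> d + 2"
    using F(2) card_mono[of "insert v (\<Union> (\<alpha> ` F))" "\<Union> (\<alpha> ` F)"] F \<alpha> by fastforce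
  moreover have "card (\<Union> (\<beta> ` F)) \<le> 2 * Suc d"
    using card_UN_le_double(2)[of F] F by auto
  ultimately show ?thesis using that[of F] F by blast
next
  case False
  have dc: "(\<Sum>v\<in>X. card {e \<in> D. v \<in> \<alpha> e}) = (\<Sum>e\<in>D. card (\<alpha> e))"
  proof -
    have "(\<Sum>v\<in>X. card {e \<in> D. v \<in> \<alpha> e}) = (\<Sum>v\<in>X. \<Sum>e\<in>D. if v \<in> \<alpha> e then 1 else 0)"
      using fin_D by (simp add: sum.If_cases Int_def)
    also have "\<dots> = (\<Sum>e\<in>D. \<Sum>v\<in>X. if v \<in> \<alpha> e then 1 else 0)"
      by (rule sum.swap)
    also have "\<dots> = (\<Sum>e\<in>D. card (\<alpha> e))"
      using sub \<open>finite X\<close> by (intro sum.cong refl) (simp add: sum.If_cases Int_absorb1)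
    finally show ?thesis .
  qed
  have pos: "1 \<le> card (\<alpha> e)" if "e \<in> D" for e
    using \<alpha>[OF that] by (simp add: card_gt_0_iff Suc_le_eq)
  have le: "(\<Sum>v\<in>X. card {e \<in> D. v \<in> \<alpha> e}) \<le> d * card X"
    using sum_bounded_above[of X "\<lambda>v. card {e \<in> D. v \<in> \<alpha> e}" d] False by (force simp: mult.commute)
  have one: "card (\<alpha> e) = 1" if "e \<in> D" for e
  proof (rule ccontr)
    assume "card (\<alpha> e) \<noteq> 1"
    then have "1 < card (\<alpha> e)" using pos[OF that] by simp
    then have "(\<Sum>e\<in>D. 1) < (\<Sum>e\<in>D. card (\<alpha> e))"
      using pos that fin_D by (intro sum_strict_mono_ex1) auto
    then show False using dc le big by simp
  qed
  have "\<exists>v\<in>X. d \<le> card {e \<in> D. v \<in> \<alpha> e}"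
  proof (rule ccontr)
    assume "\<not> ?thesis"
    then have "(\<Sum>v\<in>X. card {e \<in> D. v \<in> \<alpha> e}) < (\<Sum>v\<in>X. d)"
      using assms by (intro sum_strict_mono) auto
    then show False using dc big one by (simp add: mult.commute)
  qed
  then obtain v where "d \<le> card {e \<in> D. v \<in> \<alpha> e}" by blast
  then obtain F where F: "F \<subseteq> {e \<in> D. v \<in> \<alpha> e}" "card F = d" "finite F"
    by (rule obtain_subset_with_card_n)
  have "\<alpha> e \<subseteq> {v}" if "e \<in> F" for e
  proof -
    have "e \<in> D" "v \<in> \<alpha> e" using F(1) that by blast+
    then show ?thesis using one[of e] by (metis card_1_singletonE singletonD subset_refl)
  qed
  then have "\<Union> (\<alpha> ` F) \<subseteq> {v}" by blast
  then have a: "card (\<Union> (\<alpha> ` F)) \<le> 1" using card_mono[of "{v}"] by simp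
  have FD: "F \<subseteq> D" using F(1) by blast
  have b: "card (\<Union> (\<beta> ` F)) \<le> 2 * d" using card_UN_le_double(2)[OF FD] F(2) by simp
  have "card F + 1 \<le> card D" using F(2) assms(5) by simp
  then obtain F' where "F \<subseteq> F'" "F' \<subseteq> D" "card F' = card F + 1"
    "card (\<Union> (\<alpha> ` F')) \<le> 1 + 2 * 1" "card (\<Union> (\<beta> ` F')) \<le> 2 * d + 2 * 1"
    by (rule extend_family[OF FD _ a b])
  then show ?thesis using that[of F'] F(2) \<open>1 \<le> d\<close> by simp
qed

text \<open>A star of \<open>k + 1\<close> members at the row \<open>v\<close> costs one new row and two new columns per member, a
  star at a column \<open>w\<close> of the first star two new rows and one new column per member.\<close>

lemma two_stars:
  assumes v: "Suc k \<le> card {e \<in> D. v \<in> \<alpha> e}"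
    and w: "\<And>e w. e \<in> D \<Longrightarrow> w \<in> \<beta> e \<Longrightarrow> Suc k \<le> card {e \<in> D. w \<in> \<beta> e}"
    and D: "2 * k + 1 \<le> card D"
  obtains F where "F \<subseteq> D" "card F = 2 * k + 1"
    "card (\<Union> (\<alpha> ` F)) \<le> 3 * k + 2" "card (\<Union> (\<beta> ` F)) \<le> 3 * k + 2"
proof -
  obtain F1 where F1: "F1 \<subseteq> {e \<in> D. v \<in> \<alpha> e}" "card F1 = Suc k" "finite F1"
    using v by (rule obtain_subset_with_card_n)
  then have "F1 \<noteq> {}" by auto
  then obtain h where h: "h \<in> F1" by blast
  then obtain w where w1: "w \<in> \<beta> h" using F1 \<beta> by blast
  define Fw where "Fw = {e \<in> D. w \<in> \<beta> e}"
  have Fw: "Suc k \<le> card Fw" "finite Fw" using w[of h] F1 h w1 fin_D by (auto simp: Fw_def)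
  \<comment> \<open>\<open>r\<close> members of the first star also contain \<open>w\<close> and
    serve both stars, so \<open>Suc k - r\<close> new ones complete the star at
    \<open>w\<close>.\<close>
  define r where "r = card (F1 \<inter> Fw)"
  have "h \<in> F1 \<inter> Fw" using F1 h w1 by (auto simp: Fw_def)
  then have "r > 0" using F1 unfolding r_def by (auto simp: card_gt_0_iff)
  have "r \<le> Suc k" unfolding r_def using card_mono[of F1 "F1 \<inter> Fw"] F1 by auto
  have "Suc k - r \<le> card (Fw - F1)"
    using Fw F1 by (simp add: card_Diff_subset_Int r_def Int_commute)
  then obtain F2 where F2: "F2 \<subseteq> Fw - F1" "card F2 = Suc k - r" "finite F2"
    by (rule obtain_subset_with_card_n)
  have "card (insert v (\<Union> (\<alpha> ` F1))) \<le> Suc (card F1)"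
    using F1 \<alpha> by (intro card_UN_star_le) auto
  then have "card (\<Union> (\<alpha> ` F1)) \<le> k + 2"
    using F1(2) card_mono[of "insert v (\<Union> (\<alpha> ` F1))" "\<Union> (\<alpha> ` F1)"] F1 \<alpha> by fastforce
  moreover have "card (\<Union> (\<alpha> ` F2)) \<le> 2 * (Suc k - r)"
    using card_UN_le_double(1)[of F2] F2 Fw_def by auto
  moreover have "card (\<Union> (\<alpha> ` (F1 \<union> F2))) \<le> card (\<Union> (\<alpha> ` F1)) + card (\<Union> (\<alpha> ` F2))"
    by (simp add: image_Un card_Un_le)
  ultimately have a: "card (\<Union> (\<alpha> ` (F1 \<union> F2))) \<le> k + 2 + 2 * (Suc k - r)"
    by linarith
  \<comment> \<open>\<open>?S\<close> is a star at \<open>w\<close> on at most \<open>k + 2\<close>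
    columns; only the members of \<open>F1\<close> missing \<open>w\<close> cost two columns each.
    This mirrors the row count.\<close>
  let ?S = "(F1 \<inter> Fw) \<union> F2"
  have cS: "card ?S = Suc k"
    using F1 F2 \<open>r \<le> Suc k\<close> by (subst card_Un_disjoint) (auto simp: r_def)
  have cD: "card (F1 - Fw) = Suc k - r"
    using F1 by (simp add: card_Diff_subset_Int r_def)
  have SD: "?S \<subseteq> D" "finite ?S" using F1 F2 Fw_def by auto
  have "card (insert w (\<Union> (\<beta> ` ?S))) \<le> Suc (card ?S)"
    using SD F2 \<beta> by (intro card_UN_star_le) (auto simp: Fw_def)
  then have "card (\<Union> (\<beta> ` ?S)) \<le> k + 2"
    using cS card_mono[of "insert w (\<Union> (\<beta> ` ?S))" "\<Union> (\<beta> ` ?S)"] SD \<beta> by fastforce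
  moreover have "card (\<Union> (\<beta> ` (F1 - Fw))) \<le> 2 * (Suc k - r)"
    using card_UN_le_double(2)[of "F1 - Fw"] F1 cD by auto
  moreover have "F1 \<union> F2 = ?S \<union> (F1 - Fw)" by auto
  then have "card (\<Union> (\<beta> ` (F1 \<union> F2))) \<le> card (\<Union> (\<beta> ` ?S)) + card (\<Union> (\<beta> ` (F1 - Fw)))"
    by (metis Union_Un_distrib card_Un_le image_Un)
  ultimately have b: "card (\<Union> (\<beta> ` (F1 \<union> F2))) \<le> k + 2 + 2 * (Suc k - r)"
    by linarith
  have c: "card (F1 \<union> F2) = Suc k + (Suc k - r)"
    using F1 F2 by (subst card_Un_disjoint) auto
  have sub: "F1 \<union> F2 \<subseteq> D" using F1 F2 Fw_def by auto
  \<comment> \<open>The union has \<open>2 * k + 2 - r\<close> members, so \<open>r - 1\<close>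
    arbitrary ones are added. On each side the extra cost adds up to
    \<open>2 * (Suc k - r) + 2 * (r - 1) = 2 * k\<close>.\<close>
  have "card (F1 \<union> F2) + (r - 1) \<le> card D" using c D \<open>r > 0\<close> \<open>r \<le> Suc k\<close> by simp
  then obtain F where F: "F1 \<union> F2 \<subseteq> F" "F \<subseteq> D" "card F = card (F1 \<union> F2) + (r - 1)"
    "card (\<Union> (\<alpha> ` F)) \<le> k + 2 + 2 * (Suc k - r) + 2 * (r - 1)"
    "card (\<Union> (\<beta> ` F)) \<le> k + 2 + 2 * (Suc k - r) + 2 * (r - 1)"
    by (rule extend_family[OF sub _ a b])
  show ?thesis
    using that[of F] F c \<open>r > 0\<close> \<open>r \<le> Suc k\<close> by simp
qed

text \<open>Among the pairs \<open>(X, Y)\<close> that keep the density bound and at least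
  \<open>3 * k + 2\<close> vertices, one with fewest vertices is taken. If it has exactly
  \<open>3 * k + 2\<close>, any \<open>2 * k + 1\<close> of its members will do. Otherwise each of
  its vertices lies in more than \<open>k\<close> members, and two stars suffice.\<close>

lemma dense:
  assumes "finite X0" "finite Y0" and sub: "\<And>e. e \<in> D \<Longrightarrow> \<alpha> e \<subseteq> X0 \<and> \<beta> e \<subseteq> Y0"
    and "1 \<le> k" "3 * k + 2 \<le> card X0 + card Y0"
    and big: "k * (card X0 + card Y0 - 2) \<le> card D"
  obtains F where "F \<subseteq> D" "card F = 2 * k + 1"
    "card (\<Union> (\<alpha> ` F)) \<le> 3 * k + 2" "card (\<Union> (\<beta> ` F)) \<le> 3 * k + 2"
proof -
  define H where "H X Y = {e \<in> D. \<alpha> e \<subseteq> X \<and> \<beta> e \<subseteq> Y}" for X Y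
  define ok where "ok Z \<longleftrightarrow> (case Z of (X, Y) \<Rightarrow> finite X \<and> finite Y
    \<and> 3 * k + 2 \<le> card X + card Y \<and> k * (card X + card Y - 2) \<le> card (H X Y))" for Z
  have "H X0 Y0 = D" using sub by (auto simp: H_def)
  then have "ok (X0, Y0)" using assms by (simp add: ok_def)
  then obtain Z where Z: "ok Z"
    and min: "\<And>Z'. ok Z' \<Longrightarrow> card (fst Z) + card (snd Z) \<le> card (fst Z') + card (snd Z')"
    by (metis (full_types) ex_has_least_nat[where m = "\<lambda>Z. card (fst Z) + card (snd Z)"])
  obtain X Y where XY: "Z = (X, Y)" by (cases Z)
  have fin: "finite X" "finite Y" and ge: "3 * k + 2 \<le> card X + card Y"
    and h: "k * (card X + card Y - 2) \<le> card (H X Y)"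
    using Z by (auto simp: ok_def XY)
  have HD: "H X Y \<subseteq> D" "finite (H X Y)" using fin_D by (auto simp: H_def)
  have "3 * k \<le> k * (3 * k)" using \<open>1 \<le> k\<close> by simp
  also have "\<dots> \<le> k * (card X + card Y - 2)" using ge by (intro mult_le_mono2) simp
  finally have H_big: "2 * k + 1 \<le> card (H X Y)" using h \<open>1 \<le> k\<close> by linarith
  interpret S: small_hypergraph "H X Y" \<alpha> \<beta>
  proof
    fix e assume "e \<in> H X Y"
    then have "e \<in> D" using HD(1) by blast
    then show "finite (\<alpha> e) \<and> \<alpha> e \<noteq> {} \<and> card (\<alpha> e) \<le> 2"
      "finite (\<beta> e) \<and> \<beta> e \<noteq> {} \<and> card (\<beta> e) \<le> 2" by (fact \<alpha> \<beta>)+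
  qed (fact HD(2))
  show ?thesis
  proof (cases "card X + card Y = 3 * k + 2")
    case True
    obtain F where F: "F \<subseteq> H X Y" "card F = 2 * k + 1" "finite F"
      using H_big by (rule obtain_subset_with_card_n)
    have "\<Union> (\<alpha> ` F) \<subseteq> X" "\<Union> (\<beta> ` F) \<subseteq> Y" using F by (auto simp: H_def)
    then have "card (\<Union> (\<alpha> ` F)) \<le> card X" "card (\<Union> (\<beta> ` F)) \<le> card Y"
      using fin by (auto intro: card_mono)
    then show ?thesis using that[of F] F True HD by (auto simp: subset_iff)
  next
    case False
    \<comment> \<open>One vertex is deleted and \<open>T\<close> contains the members lost. The
      density bound drops by exactly \<open>k\<close>, so a loss of at most \<open>k\<close> members
      would contradict minimality; at least \<open>3 * k + 2\<close> vertices remain.\<close>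
    have drop: "Suc k \<le> card T"
      if "finite X'" "finite Y'" "Suc (card X' + card Y') = card X + card Y"
        and sub: "H X Y \<subseteq> H X' Y' \<union> T" and "T \<subseteq> D" for X' Y' T
    proof -
      have "\<not> ok (X', Y')" using min[of "(X', Y')"] that XY by auto
      then have lt: "card (H X' Y') < k * (card X' + card Y' - 2)"
        using that ge False by (auto simp: ok_def)
      have "finite (H X' Y' \<union> T)" using \<open>T \<subseteq> D\<close> fin_D finite_subset by (auto simp: H_def)
      then have "card (H X Y) \<le> card (H X' Y') + card T"
        using card_mono[OF _ sub] card_Un_le[of "H X' Y'" T] by linarith
      moreover have "card X + card Y - 2 = Suc (card X' + card Y' - 2)"
        using ge that \<open>1 \<le> k\<close> by linarith
      then have "k * (card X + card Y - 2) = k * (card X' + card Y' - 2) + k"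
        by simp
      ultimately show ?thesis using lt h by linarith
    qed
    have row: "Suc k \<le> card {e \<in> H X Y. v \<in> \<alpha> e}" if "v \<in> X" for v
    proof (rule drop)
      show "Suc (card (X - {v}) + card Y) = card X + card Y"
        using that fin by (metis add_Suc card.remove)
    qed (use fin HD in \<open>auto simp: H_def\<close>)
    have col: "Suc k \<le> card {e \<in> H X Y. v \<in> \<beta> e}" if "v \<in> Y" for v
    proof (rule drop)
      show "Suc (card X + card (Y - {v})) = card X + card Y"
        using that fin by (metis add_Suc_right card.remove)
    qed (use fin HD in \<open>auto simp: H_def\<close>)
    have "H X Y \<noteq> {}" using H_big by auto
    then obtain e v where "e \<in> H X Y" "v \<in> \<alpha> e" using S.\<alpha> by blast
    then have "v \<in> X" by (auto simp: H_def)
    have "Suc k \<le> card {e \<in> H X Y. w \<in> \<beta> e}" if "e \<in> H X Y" "w \<in> \<beta> e" for e w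
      using that by (intro col) (auto simp: H_def)
    then obtain F where "F \<subseteq> H X Y"
      "card F = 2 * k + 1" "card (\<Union> (\<alpha> ` F)) \<le> 3 * k + 2" "card (\<Union> (\<beta> ` F)) \<le> 3 * k + 2"
      by (rule S.two_stars[OF row[OF \<open>v \<in> X\<close>] _ H_big])
    then show ?thesis using that[of F] HD(1) by blast
  qed
qed

end

section \<open>Lower bounds\<close>

definition bip_edge :: "nat \<times> nat \<Rightarrow> (nat + nat) set" where
  "bip_edge e = {Inl (fst e), Inr (snd e)}"

lemma inj_bip_edge: "inj bip_edge"
  by (rule injI) (auto simp: bip_edge_def doubleton_eq_iff prod_eq_iff)

lemma verts_complete_bipartite [simp]: "verts (complete_bipartite m n) = {..<m} <+> {..<n}"
  by (simp add: complete_bipartite_def)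

lemma edges_complete_bipartite: "edges (complete_bipartite m n) = bip_edge ` ({..<m} \<times> {..<n})"
  unfolding complete_bipartite_def bip_edge_def by (auto simp: image_iff; blast)

lemma card_edges_complete_bipartite: "card (edges (complete_bipartite m n)) = m * n"
  unfolding edges_complete_bipartite
  by (subst card_image) (auto intro: inj_on_subset[OF inj_bip_edge] simp: card_cartesian_product)

lemma card_edges_isomorphic:
  assumes "simple_graph S" "isomorphic S H"
  shows "card (edges S) = card (edges H)"
proof -
  obtain \<phi> where \<phi>: "bij_betw \<phi> (verts S) (verts H)" "edges H = (\<lambda>e. \<phi> ` e) ` edges S"
    using assms(2) by (auto simp: isomorphic_def)
  have "inj_on (\<lambda>e. \<phi> ` e) (edges S)"
  proof (rule inj_onI)
    fix e e' assume "e \<in> edges S" "e' \<in> edges S" "\<phi> ` e = \<phi> ` e'"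
    then show "e = e'"
      using assms(1) \<phi>(1) inj_on_image_eq_iff[of \<phi> "verts S" e e']
      by (auto simp: simple_graph_def bij_betw_def)
  qed
  then show ?thesis using \<phi>(2) by (simp add: card_image)
qed

lemma card_verts_isomorphic: "isomorphic S H \<Longrightarrow> card (verts S) = card (verts H)"
  by (auto simp: isomorphic_def dest: bij_betw_same_card)

text \<open>Any \<open>s\<close> rows and \<open>t\<close> columns span a copy, by bijections with
  initial segments. The lower bounds test colorings on these copies.\<close>

lemma HQ_coloring_rectangle:
  assumes col: "HQ_coloring (complete_bipartite n n) (complete_bipartite s t) q f"
    and "U \<subseteq> {..<n}" "W \<subseteq> {..<n}" "card U = s" "card W = t"
  shows "q \<le> card ((f \<circ> bip_edge) ` (U \<times> W))"
proof -
  let ?S = "\<lparr>verts = U <+> W, edges = bip_edge ` (U \<times> W)\<rparr>"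
  have fin: "finite U" "finite W" using assms finite_subset by auto
  then obtain a b where a: "bij_betw a U {..<s}" and b: "bij_betw b W {..<t}"
    using finite_same_card_bij[of U "{..<s}"] finite_same_card_bij[of W "{..<t}"] assms by auto
  have "subgraph ?S (complete_bipartite n n)"
    using assms fin
    by (auto simp: subgraph_def simple_graph_def edges_complete_bipartite bip_edge_def)
  moreover have "isomorphic ?S (complete_bipartite s t)"
  proof -
    have "bij_betw (map_sum a b) (U <+> W) ({..<s} <+> {..<t})"
    proof (rule bij_betw_imageI)
      show "inj_on (map_sum a b) (U <+> W)"
      proof (rule inj_onI)
        fix x y assume "x \<in> U <+> W" "y \<in> U <+> W" "map_sum a b x = map_sum a b y"
        then show "x = y"
          using a b by (cases x; cases y) (auto simp: bij_betw_def inj_on_eq_iff)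
      qed
      have "map_sum a b ` (U <+> W) = (a ` U) <+> (b ` W)"
        by (simp add: Plus_def image_Un image_image)
      then show "map_sum a b ` (U <+> W) = {..<s} <+> {..<t}"
        using a b by (simp add: bij_betw_def)
    qed
    moreover have "(\<lambda>e. map_sum a b ` e) ` bip_edge ` (U \<times> W) = bip_edge ` ({..<s} \<times> {..<t})"
    proof -
      have "(\<lambda>e. map_sum a b ` e) ` bip_edge ` (U \<times> W) = bip_edge ` map_prod a b ` (U \<times> W)"
        unfolding image_image by (intro image_cong refl) (auto simp: bip_edge_def)
      also have "map_prod a b ` (U \<times> W) = {..<s} \<times> {..<t}"
        using a b by (simp add: bij_betw_def map_prod_surj_on)
      finally show ?thesis .
    qed
    ultimately show ?thesis
      unfolding isomorphic_def by (intro exI[of _ "map_sum a b"]) (simp add: edges_complete_bipartite)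
  qed
  ultimately have "q \<le> card (f ` edges ?S)" using col unfolding HQ_coloring_def by blast
  then show ?thesis by (simp add: image_image o_def)
qed

text \<open>For \<open>q \<le> s * t\<close> the coloring with pairwise distinct colors qualifies,
  so the \<open>LEAST\<close> in \<open>gen_ramsey\<close> ranges over a nonempty set and is
  attained.\<close>

lemma gen_ramsey_attained:
  assumes "q \<le> s * t"
  obtains f where "HQ_coloring (complete_bipartite n n) (complete_bipartite s t) q f"
    "card ((f \<circ> bip_edge) ` ({..<n} \<times> {..<n}))
      = gen_ramsey (complete_bipartite n n) (complete_bipartite s t) q"
proof -
  have "finite (edges (complete_bipartite n n))" by (simp add: edges_complete_bipartite)
  then obtain f :: "(nat + nat) set \<Rightarrow> nat" where f: "inj_on f (edges (complete_bipartite n n))"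
    using finite_imp_inj_to_nat_seg by blast
  have "HQ_coloring (complete_bipartite n n) (complete_bipartite s t) q f"
    unfolding HQ_coloring_def
  proof (intro allI impI; elim conjE)
    fix S :: "(nat + nat) sgraph"
    assume S: "subgraph S (complete_bipartite n n)" "isomorphic S (complete_bipartite s t)"
    have "card (f ` edges S) = card (edges S)"
      using S(1) inj_on_subset[OF f] by (intro card_image) (auto simp: subgraph_def)
    also have "\<dots> = s * t"
      using S card_edges_isomorphic[of S "complete_bipartite s t"]
      by (simp add: subgraph_def card_edges_complete_bipartite)
    finally show "q \<le> card (f ` edges S)" using assms by simp
  qed
  then have "\<exists>k f. HQ_coloring (complete_bipartite n n) (complete_bipartite s t) q f
      \<and> card (f ` edges (complete_bipartite n n)) = k" by blast
  from LeastI_ex[OF this] show ?thesis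
    using that by (auto simp: gen_ramsey_def edges_complete_bipartite image_comp)
qed

section \<open>Edges that repeat a color\<close>

lemma repeated_colors:
  assumes "finite A"
  obtains D \<rho> where "D \<subseteq> A" "card D = card A - card (g ` A)"
    "\<And>e. e \<in> D \<Longrightarrow> \<rho> e \<in> A - D \<and> g (\<rho> e) = g e"
proof -
  \<comment> \<open>\<open>R\<close> holds one root per color and \<open>D\<close> will be
    \<open>A - R\<close>, so no repeated edge serves as the root of another.\<close>
  obtain R where R: "R \<subseteq> A" "inj_on g R" "g ` A = g ` R"
    using subset_image_inj[of "g ` A" g A] by auto
  define \<rho> where "\<rho> e = (SOME r. r \<in> R \<and> g r = g e)" for e
  have "\<rho> e \<in> R \<and> g (\<rho> e) = g e" if "e \<in> A" for e
  proof -
    have "g e \<in> g ` R" using that R(3) by blast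
    then have "\<exists>r. r \<in> R \<and> g r = g e" by (metis imageE)
    then show ?thesis unfolding \<rho>_def by (rule someI_ex)
  qed
  moreover have "card (A - R) = card A - card (g ` A)"
    using R assms by (metis card_Diff_subset card_image finite_subset)
  ultimately show ?thesis using R(1) by (intro that[of "A - R" \<rho>]) auto
qed

text \<open>Deleting \<open>F\<close> loses no color, because each of its elements has a surviving
  partner of the same color. Hence every member inside a copy costs that copy a color.\<close>

lemma card_image_le_diff:
  assumes "finite B" "F \<subseteq> B" "\<And>e. e \<in> F \<Longrightarrow> \<rho> e \<in> B - F \<and> g (\<rho> e) = g e"
  shows "card (g ` B) + card F \<le> card B"
proof -
  have "g ` B = g ` (B - F)"
  proof
    show "g ` B \<subseteq> g ` (B - F)"
    proof
      fix c assume "c \<in> g ` B"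
      then obtain e where e: "e \<in> B" "c = g e" by blast
      show "c \<in> g ` (B - F)"
      proof (cases "e \<in> F")
        case True
        then show ?thesis using assms(3)[OF True] e by (metis image_eqI)
      qed (use e in blast)
    qed
  qed blast
  then have "card (g ` B) \<le> card (B - F)" using assms(1) by (simp add: card_image_le)
  then show ?thesis
    using assms card_mono[OF assms(1,2)] by (simp add: card_Diff_subset finite_subset)
qed

text \<open>Each edge \<open>e \<in> D\<close> of a coloring with few colors repeats the color of an edge \<open>\<rho> e\<close> outside
  \<open>D\<close>; the members of the associated hypergraph are the four (or three) ends of \<open>e\<close> and \<open>\<rho> e\<close>.\<close>

lemma few_repeats_in_copy:
  assumes "q \<le> s * t" "s \<le> n" "t \<le> n"
  obtains D :: "(nat \<times> nat) set" and \<rho> where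
    "small_hypergraph D (\<lambda>e. {fst e, fst (\<rho> e)}) (\<lambda>e. {snd e, snd (\<rho> e)})"
    "\<And>e. e \<in> D \<Longrightarrow> {fst e, fst (\<rho> e)} \<subseteq> {..<n} \<and> {snd e, snd (\<rho> e)} \<subseteq> {..<n}"
    "card D = n\<^sup>2 - gen_ramsey (complete_bipartite n n) (complete_bipartite s t) q"
    "\<And>F. F \<subseteq> D \<Longrightarrow> card (\<Union>e\<in>F. {fst e, fst (\<rho> e)}) \<le> s
       \<Longrightarrow> card (\<Union>e\<in>F. {snd e, snd (\<rho> e)}) \<le> t \<Longrightarrow> q + card F \<le> s * t"
proof -
  let ?A = "{..<n} \<times> {..<n}"
  obtain f where f: "HQ_coloring (complete_bipartite n n) (complete_bipartite s t) q f"
    "card ((f \<circ> bip_edge) ` ?A) = gen_ramsey (complete_bipartite n n) (complete_bipartite s t) q"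
    using gen_ramsey_attained[OF assms(1)] by blast
  obtain D \<rho> where D: "D \<subseteq> ?A" "card D = card ?A - card ((f \<circ> bip_edge) ` ?A)"
    and \<rho>: "\<And>e. e \<in> D \<Longrightarrow> \<rho> e \<in> ?A - D \<and> (f \<circ> bip_edge) (\<rho> e) = (f \<circ> bip_edge) e"
    by (rule repeated_colors[of ?A "f \<circ> bip_edge"]) auto
  have finD: "finite D" using D(1) by (rule finite_subset) simp
  have in_A: "{fst e, fst (\<rho> e)} \<subseteq> {..<n} \<and> {snd e, snd (\<rho> e)} \<subseteq> {..<n}" if "e \<in> D" for e
    using D(1) \<rho>[OF that] that by auto
  show ?thesis
  proof (rule that[of D \<rho>])
    show "small_hypergraph D (\<lambda>e. {fst e, fst (\<rho> e)}) (\<lambda>e. {snd e, snd (\<rho> e)})"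
      using finD by unfold_locales (auto simp: card_insert_if)
    show "card D = n\<^sup>2 - gen_ramsey (complete_bipartite n n) (complete_bipartite s t) q"
      using D(2) f(2) by (simp add: card_cartesian_product power2_eq_square)
    fix F assume F: "F \<subseteq> D" and le: "card (\<Union>e\<in>F. {fst e, fst (\<rho> e)}) \<le> s"
      "card (\<Union>e\<in>F. {snd e, snd (\<rho> e)}) \<le> t"
    have sub: "(\<Union>e\<in>F. {fst e, fst (\<rho> e)}) \<subseteq> {..<n}" "(\<Union>e\<in>F. {snd e, snd (\<rho> e)}) \<subseteq> {..<n}"
      using F in_A by blast+
    \<comment> \<open>The vertices met by \<open>F\<close> are padded to exactly \<open>s\<close>
      rows and \<open>t\<close> columns, which span a copy containing \<open>F\<close> and its
      roots.\<close>
    obtain U where U: "(\<Union>e\<in>F. {fst e, fst (\<rho> e)}) \<subseteq> U" "U \<subseteq> {..<n}" "card U = s"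
      using exists_subset_between[OF le(1) _ sub(1)] assms by auto
    obtain W where W: "(\<Union>e\<in>F. {snd e, snd (\<rho> e)}) \<subseteq> W" "W \<subseteq> {..<n}" "card W = t"
      using exists_subset_between[OF le(2) _ sub(2)] assms by auto
    have fin: "finite (U \<times> W)" using U(2) W(2) by (auto intro: finite_subset)
    have in_UW: "e \<in> U \<times> W \<and> \<rho> e \<in> U \<times> W" if "e \<in> F" for e
      using that U(1) W(1) by (auto simp: mem_Times_iff)
    have "card ((f \<circ> bip_edge) ` (U \<times> W)) + card F \<le> card (U \<times> W)"
    proof (rule card_image_le_diff)
      show "\<rho> e \<in> U \<times> W - F \<and> (f \<circ> bip_edge) (\<rho> e) = (f \<circ> bip_edge) e" if "e \<in> F" for e
        using in_UW[OF that] \<rho>[of e] F that by blast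
    qed (use fin in_UW in blast)+
    then show "q + card F \<le> s * t"
      using HQ_coloring_rectangle[OF f(1) U(2) W(2) U(3) W(3)] U(3) W(3)
      by (simp add: card_cartesian_product)
  qed (fact in_A)
qed

text \<open>Too few colors leave at least \<open>k * (2 * n - 2)\<close> members, the density that
  \<open>dense\<close> requires on \<open>n\<close> rows and \<open>n\<close> columns. For
  \<open>s \<le> 4\<close> one has \<open>k = 0\<close>, and the bound would ask for more than
  \<open>n^2\<close> colors on \<open>n^2\<close> edges; hence \<open>5 \<le> s\<close>.\<close>

lemma lower_bound_linear:
  fixes s t n :: nat
  assumes "5 \<le> s" "s \<le> t" "t + 3 \<le> n"
  shows "int n ^ 2 - 2 * int ((s - 2) div 3) * (int n - 1)
    < int (gen_ramsey (complete_bipartite n n) (complete_bipartite s t) (s * t - (2 * s - 1) div 3 + 1))"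
    (is "_ < int ?r")
proof (rule ccontr)
  define k where "k = (s - 2) div 3"
  define m where "m = (2 * s - 1) div 3"
  have k: "1 \<le> k" "3 * k + 2 \<le> s" and m: "1 \<le> m" "m \<le> s"
    \<comment> \<open>Let \<open>s = 3 * k + 2 + i\<close> with \<open>i \<le> 2\<close>. Then
      \<open>m = 2 * k + 1\<close> for \<open>i \<le> 1\<close>, while \<open>i = 2\<close> gives
      \<open>m = 2 * k + 2\<close> and two spare rows and columns for one further member.\<close>
    and km: "m \<le> 2 * k + 1 \<or> m = 2 * k + 2 \<and> 3 * k + 4 \<le> s"
    using assms(1) unfolding k_def m_def by linarith+
  have "m \<le> s * t" using m assms by (metis le_trans le_square mult_le_mono2)
  assume "\<not> ?thesis"
  then have "int ?r \<le> int n ^ 2 - 2 * int k * (int n - 1)" by (simp add: k_def)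
  moreover have "int (k * (2 * n - 2)) = 2 * int k * (int n - 1)"
    using assms by (simp add: of_nat_diff algebra_simps)
  ultimately have "int ?r + int (k * (2 * n - 2)) \<le> int (n\<^sup>2)"
    by (simp only: of_nat_power)
  then have r: "?r + k * (2 * n - 2) \<le> n\<^sup>2" by linarith
  have "s * t - (2 * s - 1) div 3 + 1 \<le> s * t" using m \<open>m \<le> s * t\<close> by (simp add: m_def)
  then obtain D \<rho> where
    H: "small_hypergraph D (\<lambda>e. {fst e, fst (\<rho> e)}) (\<lambda>e. {snd e, snd (\<rho> e)})"
    and sub: "\<And>e. e \<in> D \<Longrightarrow> {fst e, fst (\<rho> e)} \<subseteq> {..<n} \<and> {snd e, snd (\<rho> e)} \<subseteq> {..<n}"
    and D: "card D = n\<^sup>2 - ?r"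
    and few: "\<And>F. F \<subseteq> D \<Longrightarrow> card (\<Union>e\<in>F. {fst e, fst (\<rho> e)}) \<le> s
       \<Longrightarrow> card (\<Union>e\<in>F. {snd e, snd (\<rho> e)}) \<le> t
       \<Longrightarrow> s * t - (2 * s - 1) div 3 + 1 + card F \<le> s * t"
    by (rule few_repeats_in_copy[where n = n]) (use assms in auto)
  have D_big: "k * (2 * n - 2) \<le> card D" using D r by linarith
  have "k * 4 \<le> k * (2 * n - 2)" using assms by (intro mult_le_mono2) linarith
  then have D_k: "2 * k + 1 + 1 \<le> card D" using D_big k by linarith
  obtain F where F: "F \<subseteq> D" "card F = 2 * k + 1" "card (\<Union>e\<in>F. {fst e, fst (\<rho> e)}) \<le> 3 * k + 2"
    "card (\<Union>e\<in>F. {snd e, snd (\<rho> e)}) \<le> 3 * k + 2"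
    by (rule small_hypergraph.dense[OF H, of "{..<n}" "{..<n}" k])
      (use sub k assms D_big in \<open>auto simp: mult_2\<close>)
  have no: False if "G \<subseteq> D" "m \<le> card G" "card (\<Union>e\<in>G. {fst e, fst (\<rho> e)}) \<le> s"
    "card (\<Union>e\<in>G. {snd e, snd (\<rho> e)}) \<le> s" for G
    using few[of G] that \<open>m \<le> s * t\<close> assms m_def by simp
  show False
  proof (cases "m \<le> 2 * k + 1")
    case True
    then show False using no[OF F(1)] F k by linarith
  next
    case False
    have "card F + 1 \<le> card D" using D_k F(2) by simp
    then obtain G where "F \<subseteq> G" "G \<subseteq> D" "card G = card F + 1"
      "card (\<Union>e\<in>G. {fst e, fst (\<rho> e)}) \<le> 3 * k + 2 + 2 * 1"
      "card (\<Union>e\<in>G. {snd e, snd (\<rho> e)}) \<le> 3 * k + 2 + 2 * 1"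
      by (rule small_hypergraph.extend_family[OF H F(1) _ F(3,4)])
    then show False using no[of G] km False F(2) by linarith
  qed
qed

text \<open>With \<open>d = s - 2\<close>, at least \<open>d * n\<close> members on \<open>n\<close>
  rows yield \<open>s - 1\<close> of them on at most \<open>s\<close> rows and
  \<open>2 * (s - 1) \<le> t\<close> columns. A copy containing these has at most
  \<open>s * t - s + 1\<close> colors, one too few.\<close>

lemma lower_bound_unbalanced:
  fixes s t n :: nat
  assumes "3 \<le> s" "2 * (s - 1) \<le> t" "s + t \<le> n"
  shows "int n ^ 2 - (int s - 2) * int n + 1
    \<le> int (gen_ramsey (complete_bipartite n n) (complete_bipartite s t) (s * t - s + 2))"
    (is "_ \<le> int ?r")
proof (rule ccontr)
  define d where "d = s - 2"
  have s: "s = d + 2" "1 \<le> d" using assms by (auto simp: d_def)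
  have "2 \<le> t" using assms by simp
  then have st: "2 * s \<le> s * t" by simp
  assume "\<not> ?thesis"
  then have "int ?r + int (d * n) \<le> int (n\<^sup>2)" using s by simp
  then have r: "?r + d * n \<le> n\<^sup>2" by linarith
  have "s * t - s + 2 \<le> s * t" using st s by linarith
  then obtain D \<rho> where
    H: "small_hypergraph D (\<lambda>e. {fst e, fst (\<rho> e)}) (\<lambda>e. {snd e, snd (\<rho> e)})"
    and sub: "\<And>e. e \<in> D \<Longrightarrow> {fst e, fst (\<rho> e)} \<subseteq> {..<n} \<and> {snd e, snd (\<rho> e)} \<subseteq> {..<n}"
    and D: "card D = n\<^sup>2 - ?r"
    and few: "\<And>F. F \<subseteq> D \<Longrightarrow> card (\<Union>e\<in>F. {fst e, fst (\<rho> e)}) \<le> s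
       \<Longrightarrow> card (\<Union>e\<in>F. {snd e, snd (\<rho> e)}) \<le> t \<Longrightarrow> s * t - s + 2 + card F \<le> s * t"
    by (rule few_repeats_in_copy[where n = n]) (use assms in auto)
  have D_big: "d * n \<le> card D" using D r by linarith
  have "d * 2 \<le> d * n" using assms by (intro mult_le_mono2) linarith
  then have "Suc d \<le> card D" using D_big s by linarith
  obtain F where "F \<subseteq> D" "card F = Suc d" "card (\<Union>e\<in>F. {fst e, fst (\<rho> e)}) \<le> d + 2"
    "card (\<Union>e\<in>F. {snd e, snd (\<rho> e)}) \<le> 2 * Suc d"
    by (rule small_hypergraph.dense_rows[OF H, of "{..<n}" d])
      (use sub D_big \<open>Suc d \<le> card D\<close> s assms in \<open>auto simp: lessThan_empty_iff\<close>)
  then show False using few[of F] s assms st by simp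
qed

section \<open>Upper bound\<close>

lemma sum_weights_supersets:
  fixes p :: "'c::comm_ring_1"
  assumes "finite P" "B \<subseteq> P"
  shows "(\<Sum>I | I \<subseteq> P \<and> B \<subseteq> I. p ^ card I * (1 - p) ^ card (P - I)) = p ^ card B"
proof -
  \<comment> \<open>Put \<open>I = B \<union> J\<close> with \<open>J \<subseteq> P - B\<close>. The
    factor \<open>p ^ card B\<close> splits off; the rest expands a product of factors
    \<open>p + (1 - p) = 1\<close>.\<close>
  have "(\<Sum>I | I \<subseteq> P \<and> B \<subseteq> I. p ^ card I * (1 - p) ^ card (P - I))
    = (\<Sum>J\<in>Pow (P - B). p ^ card B * (p ^ card J * (1 - p) ^ card (P - B - J)))"
  proof (rule sum.reindex_bij_witness[of _ "\<lambda>J. B \<union> J" "\<lambda>I. I - B"])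
    fix I assume I: "I \<in> {I. I \<subseteq> P \<and> B \<subseteq> I}"
    then have "card I = card B + card (I - B)"
      using assms by (metis (mono_tags, lifting) card_Diff_subset card_mono finite_subset le_add_diff_inverse mem_Collect_eq)
    moreover have "P - B - (I - B) = P - I" using I by blast
    ultimately show "p ^ card B * (p ^ card (I - B) * (1 - p) ^ card (P - B - (I - B)))
      = p ^ card I * (1 - p) ^ card (P - I)"
      by (simp add: power_add mult.assoc)
  qed (use assms in auto)
  also have "\<dots> = p ^ card B * (\<Prod>x\<in>P - B. p + (1 - p))"
    using assms(1) by (subst prod_add) (simp_all add: sum_distrib_left)
  also have "\<dots> = p ^ card B" by simp
  finally show ?thesis .
qed

text \<open>The deletion method: \<open>p * card P - (\<Sum>B\<in>\<B>. p ^ card B)\<close> is the expectation of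
  \<open>card I - card {B \<in> \<B>. B \<subseteq> I}\<close> for a random \<open>I\<close> containing each point of \<open>P\<close>
  independently with probability \<open>p\<close>.\<close>

lemma deletion_method:
  fixes p :: real
  assumes P: "finite P" and p: "0 \<le> p" "p \<le> 1"
    and \<B>: "\<And>B. B \<in> \<B> \<Longrightarrow> B \<subseteq> P \<and> B \<noteq> {}"
  obtains I where "I \<subseteq> P" "\<forall>B\<in>\<B>. \<not> B \<subseteq> I"
    "p * card P - (\<Sum>B\<in>\<B>. p ^ card B) \<le> card I"
proof -
  define w where "w I = p ^ card I * (1 - p) ^ card (P - I)" for I
  define T where "T = p * card P - (\<Sum>B\<in>\<B>. p ^ card B)"
  have fin: "finite \<B>" using \<B> P by (meson PowI finite_Pow_iff finite_subset subsetI)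
  have w0: "0 \<le> w I" for I using p by (simp add: w_def)
  \<comment> \<open>The probability of \<open>B \<subseteq> I\<close>: the empty \<open>B\<close>
    gives total weight 1, singletons the expected size, and \<open>\<B>\<close> the expected number
    of forbidden sets in \<open>I\<close>.\<close>
  have W: "(\<Sum>I\<in>Pow P. if B \<subseteq> I then w I else 0) = p ^ card B" if "B \<subseteq> P" for B
    using sum_weights_supersets[OF P that, of p] P
    by (simp add: w_def sum.If_cases Int_def)
  have w1: "(\<Sum>I\<in>Pow P. w I) = 1" using W[of "{}"] by simp
  have A: "(\<Sum>I\<in>Pow P. w I * card I) = p * card P"
  proof -
    have "(\<Sum>I\<in>Pow P. w I * card I) = (\<Sum>I\<in>Pow P. \<Sum>x\<in>P. if {x} \<subseteq> I then w I else 0)"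
    proof (intro sum.cong refl)
      fix I assume "I \<in> Pow P"
      then have "{x \<in> P. x \<in> I} = I" by auto
      then show "w I * card I = (\<Sum>x\<in>P. if {x} \<subseteq> I then w I else 0)"
        using P by (simp add: sum.If_cases Int_def mult.commute)
    qed
    also have "\<dots> = (\<Sum>x\<in>P. \<Sum>I\<in>Pow P. if {x} \<subseteq> I then w I else 0)" by (rule sum.swap)
    also have "\<dots> = (\<Sum>x\<in>P. p)" using W[of "{_}"] by (intro sum.cong refl) simp
    finally show ?thesis by (simp add: mult.commute)
  qed
  have C: "(\<Sum>I\<in>Pow P. w I * card {B \<in> \<B>. B \<subseteq> I}) = (\<Sum>B\<in>\<B>. p ^ card B)"
  proof -
    have "(\<Sum>I\<in>Pow P. w I * card {B \<in> \<B>. B \<subseteq> I})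
      = (\<Sum>I\<in>Pow P. \<Sum>B\<in>\<B>. if B \<subseteq> I then w I else 0)"
      using fin by (simp add: sum.If_cases Int_def mult.commute)
    also have "\<dots> = (\<Sum>B\<in>\<B>. \<Sum>I\<in>Pow P. if B \<subseteq> I then w I else 0)" by (rule sum.swap)
    also have "\<dots> = (\<Sum>B\<in>\<B>. p ^ card B)" using W \<B> by (intro sum.cong refl) simp
    finally show ?thesis .
  qed
  \<comment> \<open>Some outcome reaches the expectation: otherwise nonnegative terms
    \<open>v I\<close> sum to zero, which forces every weight to vanish although the weights sum to
    1.\<close>
  have "\<exists>I\<in>Pow P. T \<le> real (card I) - card {B \<in> \<B>. B \<subseteq> I}"
  proof (rule ccontr)
    assume "\<not> ?thesis"
    then have lt: "real (card I) - card {B \<in> \<B>. B \<subseteq> I} < T" if "I \<in> Pow P" for I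
      using that by (meson linorder_not_le)
    define v where "v I = w I * (T - (real (card I) - card {B \<in> \<B>. B \<subseteq> I}))" for I
    have v0: "0 \<le> v I" if "I \<in> Pow P" for I
      unfolding v_def using w0[of I] lt[OF that] by (intro mult_nonneg_nonneg) linarith+
    have "sum v (Pow P) = T * (\<Sum>I\<in>Pow P. w I)
        - ((\<Sum>I\<in>Pow P. w I * card I) - (\<Sum>I\<in>Pow P. w I * card {B \<in> \<B>. B \<subseteq> I}))"
      by (simp add: v_def sum.distrib sum_subtractf sum_distrib_left algebra_simps)
    also have "\<dots> = 0" using w1 A C by (simp add: T_def)
    finally have v: "v I = 0" if "I \<in> Pow P" for I
      using sum_nonneg_eq_0_iff[of "Pow P" v] v0 P that by simp
    have "w I = 0" if "I \<in> Pow P" for I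
      using lt[OF that] v[OF that] by (auto simp: v_def)
    then show False using w1 by simp
  qed
  then obtain I0 where I0: "I0 \<subseteq> P" "T \<le> real (card I0) - card {B \<in> \<B>. B \<subseteq> I0}" by blast
  define bad where "bad = {B \<in> \<B>. B \<subseteq> I0}"
  \<comment> \<open>Deleting one chosen point of each forbidden set inside \<open>I0\<close>
    destroys them all and costs at most \<open>card bad\<close> points.\<close>
  define c where "c B = (SOME x. x \<in> B)" for B :: "'a set"
  have c: "c B \<in> B" if "B \<in> \<B>" for B
    using \<B>[OF that] unfolding c_def by (simp add: some_in_eq)
  have "finite bad" using fin by (simp add: bad_def)
  then have "card (c ` bad) \<le> card bad" by (rule card_image_le)
  moreover have "card I0 - card (c ` bad) \<le> card (I0 - c ` bad)"
    using \<open>finite bad\<close> by (intro diff_card_le_card_Diff) simp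
  ultimately have "real (card I0) - card bad \<le> card (I0 - c ` bad)" by linarith
  then have "T \<le> card (I0 - c ` bad)" using I0(2) by (simp add: bad_def)
  moreover have "\<forall>B\<in>\<B>. \<not> B \<subseteq> I0 - c ` bad" using c unfolding bad_def by blast
  ultimately show ?thesis using I0(1) by (intro that[of "I0 - c ` bad"]) (auto simp: T_def)
qed

text \<open>The second edge of a pair in \<open>I\<close> takes the color of the first; as
  \<open>E1\<close> and \<open>E2\<close> are disjoint, this saves \<open>card I\<close> colors. A
  copy loses colors only through pairs of \<open>I\<close> on its vertices. Sparseness concerns
  arbitrary sets of \<open>s + t\<close> vertices because either side of a copy may lie among the
  rows.\<close>

lemma matching_coloring:
  fixes n s t m :: nat and I :: "((nat \<times> nat) \<times> (nat \<times> nat)) set"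
  assumes E: "E1 \<subseteq> {..<n} \<times> {..<n}" "E2 \<subseteq> {..<n} \<times> {..<n}" "E1 \<inter> E2 = {}" and I: "I \<subseteq> E1 \<times> E2"
    and match: "\<And>x y. x \<in> I \<Longrightarrow> y \<in> I \<Longrightarrow> fst x = fst y \<or> snd x = snd y \<Longrightarrow> x = y"
    and sparse: "\<And>V. V \<subseteq> {..<n} <+> {..<n} \<Longrightarrow> card V = s + t
      \<Longrightarrow> card {x \<in> I. bip_edge (fst x) \<union> bip_edge (snd x) \<subseteq> V} \<le> m"
  shows "gen_ramsey (complete_bipartite n n) (complete_bipartite s t) (s * t - m) + card I \<le> n\<^sup>2"
proof -
  let ?A = "{..<n} \<times> {..<n}"
  define \<rho> where "\<rho> x = (if x \<in> snd ` I then SOME e. (e, x) \<in> I else x)" for x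
  have \<rho>1: "\<rho> x = e" if "(e, x) \<in> I" for e x
  proof -
    have "(SOME e. (e, x) \<in> I) = e"
    proof (rule some_equality)
      show "e' = e" if "(e', x) \<in> I" for e'
        using match[OF that \<open>(e, x) \<in> I\<close>] by simp
    qed (fact that)
    then show ?thesis using that by (force simp: \<rho>_def)
  qed
  have \<rho>2: "\<rho> x = x" if "x \<notin> snd ` I" for x using that by (simp add: \<rho>_def)
  define f where "f = prod_encode \<circ> \<rho> \<circ> inv bip_edge"
  have inv_be: "inv bip_edge (bip_edge e) = e" for e using inj_bip_edge by simp
  have card_f: "card (f ` bip_edge ` X) = card (\<rho> ` X)" for X
  proof -
    have "f ` bip_edge ` X = prod_encode ` \<rho> ` X" by (simp add: f_def image_image inv_be)
    then show ?thesis by (simp add: card_image inj_prod_encode)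
  qed
  have finI: "finite I" using I E by (meson finite_SigmaI finite_lessThan finite_subset)
  have "\<rho> ` ?A \<subseteq> ?A - snd ` I"
  proof
    fix y assume "y \<in> \<rho> ` ?A"
    then obtain x where x: "x \<in> ?A" "y = \<rho> x" by blast
    show "y \<in> ?A - snd ` I"
    proof (cases "x \<in> snd ` I")
      case True
      then obtain e where e: "(e, x) \<in> I" by auto
      then have "y \<in> E1" using x \<rho>1 I by auto
      then show ?thesis using E I by auto
    next
      case False
      then show ?thesis using x \<rho>2 by simp
    qed
  qed
  then have "card (\<rho> ` ?A) \<le> card (?A - snd ` I)" by (intro card_mono) auto
  moreover have "snd ` I \<subseteq> ?A" using I E by auto
  then have "card (?A - snd ` I) = card ?A - card (snd ` I)" "card (snd ` I) \<le> card ?A"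
    using finI by (simp add: card_Diff_subset, intro card_mono) simp_all
  moreover have "card (snd ` I) = card I"
    using match by (intro card_image inj_onI) blast
  ultimately have colors: "card (f ` edges (complete_bipartite n n)) + card I \<le> n\<^sup>2"
    unfolding edges_complete_bipartite card_f by (simp add: card_cartesian_product power2_eq_square)
  have "HQ_coloring (complete_bipartite n n) (complete_bipartite s t) (s * t - m) f"
    unfolding HQ_coloring_def
  proof (intro allI impI; elim conjE)
    fix S :: "(nat + nat) sgraph"
    assume S: "subgraph S (complete_bipartite n n)" "isomorphic S (complete_bipartite s t)"
    obtain X where X: "edges S = bip_edge ` X"
      using S(1) by (auto simp: subgraph_def edges_complete_bipartite subset_image_iff)
    have in_V: "bip_edge x \<subseteq> verts S" if "x \<in> X" for x
      using S(1) X that by (auto simp: subgraph_def simple_graph_def)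
    have "card X = s * t"
      using card_edges_isomorphic[OF _ S(2)] S(1) inj_on_subset[OF inj_bip_edge, of X]
      by (simp add: subgraph_def card_edges_complete_bipartite X card_image)
    have finX: "finite X"
    proof -
      have "X \<subseteq> ?A"
        using S(1) X inj_image_subset_iff[OF inj_bip_edge, of X ?A]
        by (simp add: subgraph_def edges_complete_bipartite)
      then show ?thesis by (rule finite_subset) simp
    qed
    \<comment> \<open>\<open>J\<close> consists of the matched pairs on the vertices of the copy.
      Once their second edges are dropped, \<open>\<rho>\<close> is injective: a remaining second
      edge takes the color of an edge outside the copy, and the matching keeps these colors
      distinct.\<close>
    define J where "J = {x \<in> I. bip_edge (fst x) \<union> bip_edge (snd x) \<subseteq> verts S}"
    have "card J \<le> m" unfolding J_def
      using S card_verts_isomorphic[OF S(2)]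
      by (intro sparse) (auto simp: subgraph_def card_Plus)
    have "finite J" using finI by (simp add: J_def)
    have "inj_on \<rho> (X - snd ` J)"
    proof -
      have unmatched: "\<rho> x \<notin> X" if "x \<in> X - snd ` J" "x \<in> snd ` I" for x
      proof
        obtain e where e: "(e, x) \<in> I" using \<open>x \<in> snd ` I\<close> by auto
        assume "\<rho> x \<in> X"
        then have "(e, x) \<in> J" using e \<rho>1[OF e] in_V[of e] in_V[of x] that by (simp add: J_def)
        then show False using that by force
      qed
      show ?thesis
      proof (rule inj_onI)
        fix x y assume x: "x \<in> X - snd ` J" and y: "y \<in> X - snd ` J" and eq: "\<rho> x = \<rho> y"
        show "x = y"
        proof (cases "x \<in> snd ` I \<and> y \<in> snd ` I")
          case True
          then obtain e e' where e: "(e, x) \<in> I" "(e', y) \<in> I" by auto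
          then show ?thesis using \<rho>1 eq match[OF e] by auto
        next
          case False
          then show ?thesis using x y eq unmatched \<rho>2 by (metis DiffD1)
        qed
      qed
    qed
    then have "card (X - snd ` J) = card (\<rho> ` (X - snd ` J))" by (simp add: card_image)
    also have "\<dots> \<le> card (\<rho> ` X)" using finX by (intro card_mono) auto
    finally have "card (X - snd ` J) \<le> card (f ` edges S)" by (simp add: X card_f)
    moreover have "card X - card (snd ` J) \<le> card (X - snd ` J)"
      using \<open>finite J\<close> by (intro diff_card_le_card_Diff) simp
    moreover have "card (snd ` J) \<le> card J" using \<open>finite J\<close> by (rule card_image_le)
    ultimately show "s * t - m \<le> card (f ` edges S)"
      using \<open>card X = s * t\<close> \<open>card J \<le> m\<close> by linarith
  qed
  then have "gen_ramsey (complete_bipartite n n) (complete_bipartite s t) (s * t - m)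
      \<le> card (f ` edges (complete_bipartite n n))"
    unfolding gen_ramsey_def by (intro Least_le) blast
  then show ?thesis using colors by linarith
qed

section \<open>Large matchings with few pairs on few vertices\<close>

lemma card_bip_edges_within:
  assumes "finite V"
  shows "finite {e. bip_edge e \<subseteq> V}" "card {e. bip_edge e \<subseteq> V} \<le> (card V)\<^sup>2"
proof -
  let ?g = "\<lambda>e. (Inl (fst e), Inr (snd e)) :: (nat + nat) \<times> (nat + nat)"
  have "inj_on ?g {e. bip_edge e \<subseteq> V}" by (auto simp: inj_on_def prod_eq_iff)
  moreover have "?g ` {e. bip_edge e \<subseteq> V} \<subseteq> V \<times> V" by (auto simp: bip_edge_def)
  moreover have "finite (V \<times> V)" using assms by simp
  ultimately show "finite {e. bip_edge e \<subseteq> V}" "card {e. bip_edge e \<subseteq> V} \<le> (card V)\<^sup>2"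
    using card_inj_on_le[of ?g _ "V \<times> V"] inj_on_finite[of ?g _ "V \<times> V"]
    by (auto simp: card_cartesian_product power2_eq_square)
qed

text \<open>Deletion method on \<open>E1 \<times> E2\<close> with two kinds of forbidden sets: two
  pairs sharing an edge (\<open>\<B>2\<close>), whose absence makes \<open>I\<close> a matching, and
  \<open>m + 1\<close> pairs on \<open>u\<close> vertices (\<open>\<B>r\<close>), whose absence
  makes it sparse. The subtracted terms bound their expected numbers.\<close>

lemma sparse_matching:
  fixes p :: real and n m u :: nat
  assumes p: "0 \<le> p" "p \<le> 1"
    and E: "E1 \<subseteq> {..<n} \<times> {..<n}" "E2 \<subseteq> {..<n} \<times> {..<n}"
  obtains I where "I \<subseteq> E1 \<times> E2"
    "\<forall>x\<in>I. \<forall>y\<in>I. fst x = fst y \<or> snd x = snd y \<longrightarrow> x = y"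
    "\<forall>V. V \<subseteq> {..<n} <+> {..<n} \<and> card V = u
      \<longrightarrow> card {x \<in> I. bip_edge (fst x) \<union> bip_edge (snd x) \<subseteq> V} \<le> m"
    "p * (card E1 * card E2) - 2 * real n ^ 6 * p\<^sup>2 - 2 ^ (u + u ^ 4) * real n ^ u * p ^ (m + 1)
      \<le> card I"
proof -
  let ?P = "E1 \<times> E2"
  have finE: "finite E1" "finite E2" and cE: "card E1 \<le> n\<^sup>2" "card E2 \<le> n\<^sup>2"
    using finite_subset[OF E(1)] finite_subset[OF E(2)] card_mono[OF _ E(1)] card_mono[OF _ E(2)]
    by (auto simp: card_cartesian_product power2_eq_square)
  define Vs where "Vs = {V. V \<subseteq> {..<n} <+> {..<n} \<and> card V = u}"
  define \<B>2 where "\<B>2 = {B. \<exists>x\<in>?P. \<exists>y\<in>?P. x \<noteq> y \<and> (fst x = fst y \<or> snd x = snd y) \<and> B = {x, y}}"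
  define \<B>r where "\<B>r = {B. B \<subseteq> ?P \<and> card B = m + 1
    \<and> (\<exists>V\<in>Vs. \<forall>x\<in>B. bip_edge (fst x) \<union> bip_edge (snd x) \<subseteq> V)}"
  have fin2: "finite \<B>2" and finr: "finite \<B>r"
    using finE by (auto simp: \<B>2_def \<B>r_def intro!: finite_subset[of _ "Pow ?P"])
  have finP: "finite ?P" using finE by simp
  have sub: "B \<subseteq> ?P \<and> B \<noteq> {}" if "B \<in> \<B>2 \<union> \<B>r" for B
    using that by (auto simp: \<B>2_def \<B>r_def)
  obtain I where I: "I \<subseteq> ?P" "\<forall>B\<in>\<B>2 \<union> \<B>r. \<not> B \<subseteq> I"
    "p * card ?P - (\<Sum>B\<in>\<B>2 \<union> \<B>r. p ^ card B) \<le> card I"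
    by (rule deletion_method[OF finP p sub])
  have c2: "card \<B>2 \<le> 2 * n ^ 6"
  proof -
    have "\<B>2 \<subseteq> (\<lambda>(e, a, b). {(e, a), (e, b)}) ` (E1 \<times> E2 \<times> E2)
        \<union> (\<lambda>(e, a, b). {(a, e), (b, e)}) ` (E2 \<times> E1 \<times> E1)" (is "_ \<subseteq> ?X \<union> ?Y")
    proof
      fix B assume "B \<in> \<B>2"
      then obtain x y where xy: "x \<in> ?P" "y \<in> ?P" "fst x = fst y \<or> snd x = snd y" and B: "B = {x, y}"
        unfolding \<B>2_def by blast
      show "B \<in> ?X \<union> ?Y"
      proof (cases "fst x = fst y")
        case True
        then have "B = (\<lambda>(e, a, b). {(e, a), (e, b)}) (fst x, snd x, snd y)"
          by (cases x; cases y) (simp add: B)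
        moreover have "(fst x, snd x, snd y) \<in> E1 \<times> E2 \<times> E2" using xy by (simp add: mem_Times_iff)
        ultimately show ?thesis by (intro UnI1 image_eqI)
      next
        case False
        then have "B = (\<lambda>(e, a, b). {(a, e), (b, e)}) (snd x, fst x, fst y)"
          using xy(3) by (cases x; cases y) (simp add: B)
        moreover have "(snd x, fst x, fst y) \<in> E2 \<times> E1 \<times> E1" using xy by (simp add: mem_Times_iff)
        ultimately show ?thesis by (intro UnI2 image_eqI)
      qed
    qed
    then have "card \<B>2 \<le> card (?X \<union> ?Y)" using finE by (intro card_mono) auto
    also have "\<dots> \<le> card ?X + card ?Y" by (rule card_Un_le)
    also have "card ?X \<le> card (E1 \<times> E2 \<times> E2)" using finE by (intro card_image_le) auto
    also have "card ?Y \<le> card (E2 \<times> E1 \<times> E1)" using finE by (intro card_image_le) auto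
    also have "card (E1 \<times> E2 \<times> E2) \<le> n\<^sup>2 * (n\<^sup>2 * n\<^sup>2)"
      unfolding card_cartesian_product by (intro mult_le_mono cE)
    also have "card (E2 \<times> E1 \<times> E1) \<le> n\<^sup>2 * (n\<^sup>2 * n\<^sup>2)"
      unfolding card_cartesian_product by (intro mult_le_mono cE)
    finally show ?thesis by (simp add: power_add[symmetric])
  qed
  have cr: "card \<B>r \<le> 2 ^ (u + u ^ 4) * n ^ u"
  proof -
    define Q where "Q V = {e. bip_edge e \<subseteq> V}" for V
    have finVs: "finite Vs" by (simp add: Vs_def)
    have finV: "finite V" if "V \<in> Vs" for V
      using that by (auto simp: Vs_def intro: finite_subset)
    have Q: "finite (Q V)" "card (Q V) \<le> u\<^sup>2" if "V \<in> Vs" for V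
      using card_bip_edges_within[OF finV[OF that]] that by (simp_all add: Q_def Vs_def)
    \<comment> \<open>A crude count: at most \<open>(2 * n) ^ u\<close> sets \<open>V\<close>, each
      with at most \<open>u ^ 4\<close> pairs of edges inside, hence at most
      \<open>2 ^ (u ^ 4)\<close> sets of pairs.\<close>
    have "\<B>r \<subseteq> (\<Union>V\<in>Vs. Pow (Q V \<times> Q V))"
    proof
      fix B assume "B \<in> \<B>r"
      then obtain V where V: "V \<in> Vs" "\<forall>x\<in>B. bip_edge (fst x) \<union> bip_edge (snd x) \<subseteq> V"
        unfolding \<B>r_def by blast
      have "x \<in> Q V \<times> Q V" if "x \<in> B" for x
        using V(2) that by (simp add: mem_Times_iff Q_def)
      then show "B \<in> (\<Union>V\<in>Vs. Pow (Q V \<times> Q V))" using V(1) by blast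
    qed
    moreover have "finite (\<Union>V\<in>Vs. Pow (Q V \<times> Q V))"
      using finVs Q(1) by simp
    ultimately have "card \<B>r \<le> card (\<Union>V\<in>Vs. Pow (Q V \<times> Q V))" by (intro card_mono)
    also have "\<dots> \<le> (\<Sum>V\<in>Vs. card (Pow (Q V \<times> Q V)))" using finVs by (rule card_UN_le)
    also have "\<dots> \<le> card Vs * 2 ^ (u ^ 4)"
    proof -
      have "card (Pow (Q V \<times> Q V)) \<le> 2 ^ (u ^ 4)" if V: "V \<in> Vs" for V
      proof -
        have "card (Q V \<times> Q V) \<le> u\<^sup>2 * u\<^sup>2"
          unfolding card_cartesian_product by (intro mult_le_mono Q V)
        then show ?thesis
          using Q(1)[OF V] by (simp add: card_Pow power_add[symmetric])
      qed
      from sum_bounded_above[of Vs, OF this] show ?thesis by simp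
    qed
    also have "card Vs \<le> (2 * n) ^ u"
    proof -
      have "card Vs = (card ({..<n} <+> {..<n})) choose u" unfolding Vs_def by (intro n_subsets) simp
      also have "\<dots> = (2 * n) choose u" by (simp add: card_Plus mult_2)
      also have "\<dots> \<le> (2 * n) ^ u"
        by (metis binomial_eq_0 binomial_le_pow linorder_not_le zero_le)
      finally show ?thesis .
    qed
    finally show ?thesis by (simp add: power_mult_distrib power_add mult_ac)
  qed
  have "(\<Sum>B\<in>\<B>2 \<union> \<B>r. p ^ card B) \<le> (\<Sum>B\<in>\<B>2. p ^ card B) + (\<Sum>B\<in>\<B>r. p ^ card B)"
    using sum.union_inter[OF fin2 finr, of "\<lambda>B. p ^ card B"]
      sum_nonneg[of "\<B>2 \<inter> \<B>r" "\<lambda>B. p ^ card B"] p by simp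
  also have "(\<Sum>B\<in>\<B>2. p ^ card B) = card \<B>2 * p\<^sup>2"
  proof -
    have "card B = 2" if "B \<in> \<B>2" for B using that unfolding \<B>2_def card_2_iff by blast
    then show ?thesis by simp
  qed
  also have "(\<Sum>B\<in>\<B>r. p ^ card B) = card \<B>r * p ^ (m + 1)"
    by (simp add: \<B>r_def)
  also have "card \<B>2 * p\<^sup>2 \<le> 2 * real n ^ 6 * p\<^sup>2"
    using of_nat_mono[OF c2, where 'a = real] by (intro mult_right_mono) simp_all
  also have "card \<B>r * p ^ (m + 1) \<le> 2 ^ (u + u ^ 4) * real n ^ u * p ^ (m + 1)"
    using of_nat_mono[OF cr, where 'a = real] p by (intro mult_right_mono) simp_all
  finally have "p * (card E1 * card E2) - 2 * real n ^ 6 * p\<^sup>2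
      - 2 ^ (u + u ^ 4) * real n ^ u * p ^ (m + 1) \<le> card I"
    using I(3) by (simp add: card_cartesian_product)
  moreover have "x = y" if "x \<in> I" "y \<in> I" "fst x = fst y \<or> snd x = snd y" for x y
  proof (rule ccontr)
    assume "x \<noteq> y"
    then have "{x, y} \<in> \<B>2" using that I(1) unfolding \<B>2_def by blast
    then have "\<not> {x, y} \<subseteq> I" using I(2) by (meson UnI1)
    then show False using that by simp
  qed
  moreover have "card {x \<in> I. bip_edge (fst x) \<union> bip_edge (snd x) \<subseteq> V} \<le> m"
    if "V \<subseteq> {..<n} <+> {..<n}" "card V = u" for V
  proof (rule ccontr)
    assume "\<not> ?thesis"
    then have "m + 1 \<le> card {x \<in> I. bip_edge (fst x) \<union> bip_edge (snd x) \<subseteq> V}" by simp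
    then obtain B where B: "B \<subseteq> {x \<in> I. bip_edge (fst x) \<union> bip_edge (snd x) \<subseteq> V}"
      "card B = m + 1" "finite B"
      by (rule obtain_subset_with_card_n)
    then have "B \<subseteq> I" by blast
    have "\<forall>x\<in>B. bip_edge (fst x) \<union> bip_edge (snd x) \<subseteq> V" using B(1) by blast
    moreover have "V \<in> Vs" using that by (simp add: Vs_def)
    ultimately have "B \<in> \<B>r" using \<open>B \<subseteq> I\<close> B(2) I(1) unfolding \<B>r_def by blast
    then show False using I(2) \<open>B \<subseteq> I\<close> by (meson UnI2)
  qed
  ultimately show ?thesis using I(1) by (intro that[of I]) simp_all
qed

text \<open>For \<open>p = \<epsilon> * n powr (\<delta> - 3)\<close> the main term has order
  \<open>\<epsilon> * n powr (1 + \<delta>)\<close>, while the error terms carry a factor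
  \<open>\<epsilon>^2\<close> and no higher power of \<open>n\<close>.\<close>

lemma upper_bound_polynomial:
  fixes s t :: nat
  assumes "8 \<le> s + t"
  obtains c :: real where "c > 0" "\<And>n. 2 \<le> n \<Longrightarrow>
    real (gen_ramsey (complete_bipartite n n) (complete_bipartite s t) (s * t - (s + t - 1) div 3))
      < real n ^ 2 - c * real n powr (1 + 3 / (real s + real t - 3))"
proof -
  define u where "u = s + t"
  define m where "m = (u - 1) div 3"
  define \<delta> where "\<delta> = 3 / (real u - 3)"
  define K :: real where "K = 2 ^ (u + u ^ 4)"
  \<comment> \<open>Chosen so that the errors, with coefficients \<open>2 * \<epsilon>^2\<close> and
    \<open>K * \<epsilon>^2\<close>, sum to \<open>\<epsilon> / 18\<close>, half of the main
    coefficient \<open>\<epsilon> / 9\<close>.\<close>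
  define \<epsilon> where "\<epsilon> = 1 / (18 * (K + 2))"
  have u: "8 \<le> u" using assms by (simp add: u_def)
  have \<delta>: "0 < \<delta>" "\<delta> \<le> 1" using u by (auto simp: \<delta>_def divide_simps)
  have K: "1 \<le> K" by (simp add: K_def)
  have \<epsilon>: "0 < \<epsilon>" "\<epsilon> \<le> 1" "(K + 2) * \<epsilon> = 1 / 18" using K by (auto simp: \<epsilon>_def divide_simps)
  have m: "1 \<le> m" "u \<le> 3 * m + 3" using u unfolding m_def by linarith+
  \<comment> \<open>This inequality determines \<open>\<delta>\<close>: as
    \<open>m \<ge> (u - 3) / 3\<close>, forbidden sets of \<open>m + 1\<close> pairs contribute no
    higher power of \<open>n\<close> than the main term, with equality at
    \<open>u = 3 * m + 3\<close>.\<close>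
  have expo: "real u + real (m + 1) * (\<delta> - 3) \<le> 1 + \<delta>"
  proof -
    have "real m * (\<delta> - 3) \<le> (real u - 3) / 3 * (\<delta> - 3)"
      using m \<delta> by (intro mult_right_mono_neg) auto
    also have "\<dots> = 4 - real u" using u by (simp add: \<delta>_def field_simps)
    finally show ?thesis by (simp add: algebra_simps)
  qed
  have main: "real (gen_ramsey (complete_bipartite n n) (complete_bipartite s t) (s * t - m))
    < real n ^ 2 - \<epsilon> / 36 * real n powr (1 + \<delta>)" if n: "2 \<le> n" for n
  proof -
    let ?N = "real n powr (1 + \<delta>)"
    define p where "p = \<epsilon> * real n powr (\<delta> - 3)"
    have "real n powr (\<delta> - 3) \<le> real n powr 0" using n \<delta> by (intro powr_mono) auto
    then have p: "0 \<le> p" "p \<le> 1"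
      using \<epsilon> n mult_mono[of \<epsilon> 1 "real n powr (\<delta> - 3)" 1] by (auto simp: p_def)
    have p_pow: "p ^ j = \<epsilon> ^ j * real n powr (real j * (\<delta> - 3))" for j
      using n by (simp add: p_def power_mult_distrib powr_power mult.commute)
    have n_pow: "real n ^ i * p ^ j = \<epsilon> ^ j * real n powr (real i + real j * (\<delta> - 3))" for i j
      using n by (simp add: p_pow powr_add powr_realpow)
    \<comment> \<open>Two blocks of \<open>h\<close> rows keep \<open>E1\<close> and
      \<open>E2\<close> disjoint; an odd \<open>n\<close> leaves out one row. From
      \<open>n = 2\<close> on, \<open>n \<le> 3 * h\<close>, the source of the factor 9.\<close>
    define h where "h = n div 2"
    define E1 where "E1 = {..<h} \<times> {..<n}"
    define E2 where "E2 = {h..<2 * h} \<times> {..<n}"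
    have E: "E1 \<subseteq> {..<n} \<times> {..<n}" "E2 \<subseteq> {..<n} \<times> {..<n}" "E1 \<inter> E2 = {}"
      by (auto simp: E1_def E2_def h_def)
    obtain I where I: "I \<subseteq> E1 \<times> E2"
      "\<forall>x\<in>I. \<forall>y\<in>I. fst x = fst y \<or> snd x = snd y \<longrightarrow> x = y"
      "\<forall>V. V \<subseteq> {..<n} <+> {..<n} \<and> card V = u
        \<longrightarrow> card {x \<in> I. bip_edge (fst x) \<union> bip_edge (snd x) \<subseteq> V} \<le> m"
      "p * (card E1 * card E2) - 2 * real n ^ 6 * p\<^sup>2 - 2 ^ (u + u ^ 4) * real n ^ u * p ^ (m + 1)
        \<le> card I"
      by (rule sparse_matching[OF p E(1,2)])
    have "gen_ramsey (complete_bipartite n n) (complete_bipartite s t) (s * t - m) + card I \<le> n\<^sup>2"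
      by (rule matching_coloring[OF E I(1)]) (use I(2,3) u_def in blast)+
    then have ub: "real (gen_ramsey (complete_bipartite n n) (complete_bipartite s t) (s * t - m))
        + card I \<le> real n ^ 2"
      by (metis of_nat_add of_nat_le_iff of_nat_power)
    have "n \<le> 3 * h" using n by (simp add: h_def)
    then have "(n * n) * (n * n) \<le> (3 * h * n) * (3 * h * n)" by (intro mult_le_mono) auto
    also have "\<dots> = 9 * (card E1 * card E2)" by (simp add: E1_def E2_def card_cartesian_product)
    finally have "real ((n * n) * (n * n)) \<le> real (9 * (card E1 * card E2))"
      by (simp only: of_nat_le_iff)
    then have "real n ^ 4 \<le> 9 * (real (card E1) * real (card E2))"
      by (simp add: power4_eq_xxxx mult.assoc)
    then have "real n ^ 4 * p ^ 1 \<le> 9 * (real (card E1) * real (card E2)) * p"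
      using p by (simp add: mult_right_mono)
    then have t1: "\<epsilon> * ?N \<le> 9 * (p * (card E1 * card E2))"
      unfolding n_pow by (simp add: mult_ac)
    \<comment> \<open>Here \<open>\<delta> \<le> 1\<close> enters: the exponent
      \<open>6 + 2 * (\<delta> - 3) = 2 * \<delta>\<close> is at most
      \<open>1 + \<delta>\<close>.\<close>
    have t2: "real n ^ 6 * p\<^sup>2 \<le> \<epsilon>\<^sup>2 * ?N"
      unfolding n_pow using n \<delta> by (intro mult_left_mono powr_mono) auto
    have t3: "real n ^ u * p ^ (m + 1) \<le> \<epsilon>\<^sup>2 * ?N"
      unfolding n_pow
      using n expo \<epsilon> m by (intro mult_mono powr_mono power_decreasing) auto
    have "\<epsilon>\<^sup>2 * ?N * (K + 2) = \<epsilon> * ?N / 18"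
      using \<epsilon>(3) by (simp add: power2_eq_square mult_ac)
    moreover have "K * (real n ^ u * p ^ (m + 1)) \<le> K * (\<epsilon>\<^sup>2 * ?N)"
      using t3 K by (intro mult_left_mono) auto
    ultimately have "\<epsilon> * ?N / 18 \<le> card I"
      using I(4) t1 t2 unfolding K_def[symmetric] by (simp add: algebra_simps)
    moreover have "0 < \<epsilon> * ?N" using \<epsilon> n by simp
    ultimately show ?thesis using ub by simp
  qed
  show ?thesis
    by (rule that[of "\<epsilon> / 36"]) (use \<epsilon> main in \<open>auto simp: u_def m_def \<delta>_def\<close>)
qed

theorem theoremC1:
  fixes s t :: nat
  assumes "2 \<le> s" and "s \<le> t"
  shows
    "(5 \<le> s \<longrightarrow>
        (\<forall>\<^sub>F n in sequentially.
           int (gen_ramsey (complete_bipartite n n) (complete_bipartite s t)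
                  (s * t - (2 * s - 1) div 3 + 1))
             > int n ^ 2 - 2 * int ((s - 2) div 3) * (int n - 1)))
     \<and> (3 \<le> s \<and> 2 * (s - 1) \<le> t \<longrightarrow>
        (\<forall>\<^sub>F n in sequentially.
           int (gen_ramsey (complete_bipartite n n) (complete_bipartite s t) (s * t - s + 2))
             \<ge> int n ^ 2 - (int s - 2) * int n + 1))
     \<and> (8 \<le> s + t \<longrightarrow>
        (\<exists>c::real. c > 0 \<and>
          (\<forall>\<^sub>F n in sequentially.
             real (gen_ramsey (complete_bipartite n n) (complete_bipartite s t)
                     (s * t - (s + t - 1) div 3))
               < real n ^ 2 - c * real n powr (1 + 3 / (real s + real t - 3)))))"
proof (intro conjI impI)
  assume "5 \<le> s"
  then show "\<forall>\<^sub>F n in sequentially.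
      int (gen_ramsey (complete_bipartite n n) (complete_bipartite s t)
        (s * t - (2 * s - 1) div 3 + 1))
      > int n ^ 2 - 2 * int ((s - 2) div 3) * (int n - 1)"
    using lower_bound_linear[OF _ assms(2)] by (intro eventually_sequentiallyI[of "t + 3"])
next
  assume "3 \<le> s \<and> 2 * (s - 1) \<le> t"
  then show "\<forall>\<^sub>F n in sequentially.
      int (gen_ramsey (complete_bipartite n n) (complete_bipartite s t) (s * t - s + 2))
      \<ge> int n ^ 2 - (int s - 2) * int n + 1"
    using lower_bound_unbalanced by (intro eventually_sequentiallyI[of "s + t"]) blast
next
  assume "8 \<le> s + t"
  then obtain c :: real where c: "c > 0" "\<And>n. 2 \<le> n \<Longrightarrow>
    real (gen_ramsey (complete_bipartite n n) (complete_bipartite s t) (s * t - (s + t - 1) div 3))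
      < real n ^ 2 - c * real n powr (1 + 3 / (real s + real t - 3))"
    using upper_bound_polynomial by blast
  then show "\<exists>c::real. c > 0 \<and> (\<forall>\<^sub>F n in sequentially.
      real (gen_ramsey (complete_bipartite n n) (complete_bipartite s t) (s * t - (s + t - 1) div 3))
      < real n ^ 2 - c * real n powr (1 + 3 / (real s + real t - 3)))"
    by (intro exI[of _ c] conjI eventually_sequentiallyI[of 2])
qed

end
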